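(* Let $M$ be a vector space and $T_M\in\mathrm{End}_k(M)$. Then $(M,[\cdot,\cdot,\cdot]_M,T_M)$, with the trivial (zero) $3$-Lie bracket $[\cdot,\cdot,\cdot]_M$, is a Rota-Baxter $3$-Lie algebra of weight $\lambda$. Let $(\mathfrak g,[\cdot,\cdot,\cdot],T)$ be a Rota-Baxter $3$-Lie algebra of weight $\lambda$. Two isomorphic abelian extensions of $(\mathfrak g,[\cdot,\cdot,\cdot],T)$ by $(M,[\cdot,\cdot,\cdot]_M,T_M)$ give rise to the same cohomology class in the second cohomology group $\mathrm H^2(\mathfrak g,M)$ of the Rota-Baxter $3$-Lie algebra $(\mathfrak g,[\cdot,\cdot,\cdot],T)$ of weight $\lambda$ with coefficients in $M$.
   Context: Let $k$ be a field of characteristic $0$; vector spaces are over $k$; $\lambda\in k$. A $3$-Lie algebra is a vector space $\mathfrak g$ with a linear map $[\cdot,\cdot,\cdot]:\wedge^3\mathfrak g\to\mathfrak g$ such that $[x_1,x_2,[x_3,x_4,x_5]]=[[x_1,x_2,x_3],x_4,x_5]+[x_3,[x_1,x_2,x_4],x_5]+[x_3,x_4,[x_1,x_2,x_5]]$. A representation on $M$ is a linear map $\rho:\wedge^2\mathfrak g\to\mathfrak{gl}(M)$ with $\rho(x_1,x_2)\rho(x_3,x_4)=\rho([x_1,x_2,x_3],x_4)+\rho(x_3,[x_1,x_2,x_4])+\rho(x_3,x_4)\rho(x_1,x_2)$ and $\rho(x_1,[x_2,x_3,x_4])=\rho(x_3,x_4)\rho(x_1,x_2)-\rho(x_2,x_4)\rho(x_1,x_3)+\rho(x_2,x_3)\rho(x_1,x_4)$.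 A Rota-Baxter $3$-Lie algebra of weight $\lambda$ is a $3$-Lie algebra with a linear map $T:\mathfrak g\to\mathfrak g$ such that $[T(x),T(y),T(z)]=T([x,y,z]_T)$, where $[x,y,z]_T:=[T(x),T(y),z]+[T(x),y,T(z)]+[x,T(y),T(z)]+\lambda[T(x),y,z]+\lambda[x,T(y),z]+\lambda[x,y,T(z)]+\lambda^2[x,y,z]$. Morphisms are $3$-Lie algebra homomorphisms commuting with the operators. A representation is a triple $(M,\rho,T_M)$ with $(M,\rho)$ a representation of the $3$-Lie algebra and $T_M\in\mathrm{End}(M)$ satisfying $\rho(T(x),T(y))T_M(m)=T_M\big(\rho(T(x),T(y))m+\rho(T(x),y)T_M(m)+\rho(x,T(y))T_M(m)+\lambda\rho(T(x),y)m+\lambda\rho(x,T(y))m+\lambda\rho(x,y)T_M(m)+\lambda^2\rho(x,y)m\big)$. An abelian extension of $(\mathfrak g,[\cdot,\cdot,\cdot],T)$ by $(M,[\cdot,\cdot,\cdot]_M,T_M)$ is a short exact sequence $0\to(M,[\cdot,\cdot,\cdot]_M,T_M)\xrightarrow{i}(\hat{\mathfrak g},[\cdot,\cdot,\cdot]_{\hat{\mathfrak g}},\hat T)\xrightarrow{p}(\mathfrak g,[\cdot,\cdot,\cdot],T)\to0$ of morphisms of Rota-Baxter $3$-Lie algebras of weight $\lambda$ such that $[u,i(m),i(n)]_{\hat{\mathfrak g}}=0$ for all $u\in\hat{\mathfrak g}$, $m,n\in M$. Two abelian extensions $(\hat{\mathfrak g}_1,i_1,p_1)$, $(\hat{\mathfrak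 g}_2,i_2,p_2)$ are isomorphic if there is an isomorphism $\zeta:\hat{\mathfrak g}_1\to\hat{\mathfrak g}_2$ of Rota-Baxter $3$-Lie algebras of weight $\lambda$ with $\zeta\circ i_1=i_2$ and $p_2\circ\zeta=p_1$. Given an abelian extension and a section $s$ (a linear map $s:\mathfrak g\to\hat{\mathfrak g}$ with $p\circ s=\mathrm{Id}_{\mathfrak g}$), identify $M$ with $i(M)$ and put $\rho(x,y)m=[s(x),s(y),i(m)]_{\hat{\mathfrak g}}$, $\psi(x,y,z)=[s(x),s(y),s(z)]_{\hat{\mathfrak g}}-s([x,y,z])$, $\chi(x)=\hat T(s(x))-s(T(x))$. Then $(M,\rho,T_M)$ is a representation of $(\mathfrak g,[\cdot,\cdot,\cdot],T)$ independent of $s$, the pair $(\psi,\chi)$ is a $2$-cocycle with coefficients in it, and its class is independent of $s$. The class of $(\psi,\chi)$ is the cohomology class the extension gives rise to; $\mathrm H^2(\mathfrak g,M)$ is taken with coefficients in the representation induced on $M$ in this way. Second cohomology group. Put $\rho_T(x,y)m=\rho(T(x),T(y))m-T_M\big(\rho(T(x),y)m+\rho(x,T(y))m+\lambda\rho(x,y)m\big)$. The $1$-cochains are $\mathrm{Hom}(\mathfrak g,M)\oplus M$ and the $2$-cochains are $\mathrm{Hom}(\wedge^3\mathfrak g,M)\oplus\mathrm{Hom}(\mathfrak g,M)$. The differentials are $d^1(f,a)=(\delta^1f,-\partial^0a-\Phi^1f)$ and $d^2(f,g)=(\delta^2f,-\partial^1g-\Phi^2f)$, where $(\delta^1f)(x,y,z)=-f([x,y,z])+\rho(x,y)f(z)+\rho(y,z)f(x)+\rho(z,x)f(y)$;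 $\Phi^1f=f\circ T-T_M\circ f$; $(\delta^2f)(x_1,\dots,x_5)=-f([x_1,x_2,x_3],x_4,x_5)-f(x_3,[x_1,x_2,x_4],x_5)-f(x_3,x_4,[x_1,x_2,x_5])+f(x_1,x_2,[x_3,x_4,x_5])+\rho(x_1,x_2)f(x_3,x_4,x_5)-\rho(x_3,x_4)f(x_1,x_2,x_5)-\rho(x_4,x_5)f(x_1,x_2,x_3)-\rho(x_5,x_3)f(x_1,x_2,x_4)$; $(\partial^1g)(x,y,z)=-g([x,y,z]_T)+\rho_T(x,y)g(z)+\rho_T(y,z)g(x)+\rho_T(z,x)g(y)$; $(\Phi^2f)(x,y,z)=f(T(x),T(y),T(z))-T_M\big(f(T(x),T(y),z)+f(T(x),y,T(z))+f(x,T(y),T(z))+\lambda f(T(x),y,z)+\lambda f(x,T(y),z)+\lambda f(x,y,T(z))+\lambda^2f(x,y,z)\big)$. Here $\delta^0:M\to\mathrm{Hom}(\mathfrak g,M)$ and $\partial^0:M\to\mathrm{Hom}(\mathfrak g,M)$ denote the degree-$0$ coboundaries of the $3$-Lie algebra complex and of the Rota-Baxter operator complex; they satisfy $\delta^1\circ\delta^0=0$ and $\partial^0=\Phi^1\circ\delta^0$, so that $\operatorname{im}d^1=\{(\delta^1f,-\Phi^1f): f\in\mathrm{Hom}(\mathfrak g,M)\}$. The second cohomology group is $\mathrm H^2(\mathfrak g,M)=\ker d^2/\operatorname{im}d^1$. *)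

theory Defs
  imports Complex_Main "HOL-Library.Function_Algebras" "HOL-Library.Product_Plus"
    "HOL-Library.Set_Algebras"
begin

text \<open>
  A vector space over the field \<open>'k\<close> is a type of class \<open>ab_group_add\<close> together with a
  scalar multiplication satisfying the library predicate \<^const>\<open>vector_space\<close>; its underlying
  set is the whole type.  A linear map out of an exterior power is rendered as a curried
  alternating multilinear map.  Sums of maps and of pairs of maps are pointwise, from
  \<^theory>\<open>HOL-Library.Function_Algebras\<close> and \<^theory>\<open>HOL-Library.Product_Plus\<close>.
\<close>

definition alternating_bilinear ::
    "('k::field \<Rightarrow> 'v::ab_group_add \<Rightarrow> 'v) \<Rightarrow> ('k \<Rightarrow> 'w::ab_group_add \<Rightarrow> 'w)
      \<Rightarrow> ('v \<Rightarrow> 'v \<Rightarrow> 'w) \<Rightarrow> bool" where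
  "alternating_bilinear sv sw f \<longleftrightarrow>
     (\<forall>y. Vector_Spaces.linear sv sw (\<lambda>x. f x y)) \<and>
     (\<forall>x. Vector_Spaces.linear sv sw (\<lambda>y. f x y)) \<and>
     (\<forall>x. f x x = 0)"

definition alternating_trilinear ::
    "('k::field \<Rightarrow> 'v::ab_group_add \<Rightarrow> 'v) \<Rightarrow> ('k \<Rightarrow> 'w::ab_group_add \<Rightarrow> 'w)
      \<Rightarrow> ('v \<Rightarrow> 'v \<Rightarrow> 'v \<Rightarrow> 'w) \<Rightarrow> bool" where
  "alternating_trilinear sv sw f \<longleftrightarrow>
     (\<forall>y z. Vector_Spaces.linear sv sw (\<lambda>x. f x y z)) \<and>
     (\<forall>x z. Vector_Spaces.linear sv sw (\<lambda>y. f x y z)) \<and>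
     (\<forall>x y. Vector_Spaces.linear sv sw (\<lambda>z. f x y z)) \<and>
     (\<forall>x y. f x x y = 0 \<and> f x y y = 0 \<and> f x y x = 0)"


section \<open>Rota-Baxter 3-Lie algebras\<close>

record ('k, 'v) rb3 =
  smul :: "'k \<Rightarrow> 'v \<Rightarrow> 'v"
  brk :: "'v \<Rightarrow> 'v \<Rightarrow> 'v \<Rightarrow> 'v"
  rbop :: "'v \<Rightarrow> 'v"

definition three_Lie_algebra ::
    "('k::field \<Rightarrow> 'v::ab_group_add \<Rightarrow> 'v) \<Rightarrow> ('v \<Rightarrow> 'v \<Rightarrow> 'v \<Rightarrow> 'v) \<Rightarrow> bool" where
  "three_Lie_algebra sv b \<longleftrightarrow>
     vector_space sv \<and> alternating_trilinear sv sv b \<and>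
     (\<forall>x1 x2 x3 x4 x5.
        b x1 x2 (b x3 x4 x5) =
          b (b x1 x2 x3) x4 x5 + b x3 (b x1 x2 x4) x5 + b x3 x4 (b x1 x2 x5))"

text \<open>The bracket \<open>[x, y, z]\<^sub>T\<close>.\<close>

definition brkT :: "'k::field \<Rightarrow> ('k, 'v::ab_group_add) rb3 \<Rightarrow> 'v \<Rightarrow> 'v \<Rightarrow> 'v \<Rightarrow> 'v" where
  "brkT lam A x y z =
     (let b = brk A; T = rbop A; s = smul A in
       b (T x) (T y) z + b (T x) y (T z) + b x (T y) (T z)
       + s lam (b (T x) y z) + s lam (b x (T y) z) + s lam (b x y (T z))
       + s (lam\<^sup>2) (b x y z))"

definition RB3_Lie_algebra :: "'k::field \<Rightarrow> ('k, 'v::ab_group_add) rb3 \<Rightarrow> bool" where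
  "RB3_Lie_algebra lam A \<longleftrightarrow>
     three_Lie_algebra (smul A) (brk A) \<and>
     Vector_Spaces.linear (smul A) (smul A) (rbop A) \<and>
     (\<forall>x y z. brk A (rbop A x) (rbop A y) (rbop A z) = rbop A (brkT lam A x y z))"

definition RB3_hom ::
    "('k::field, 'v::ab_group_add) rb3 \<Rightarrow> ('k, 'w::ab_group_add) rb3 \<Rightarrow> ('v \<Rightarrow> 'w) \<Rightarrow> bool" where
  "RB3_hom A B f \<longleftrightarrow>
     Vector_Spaces.linear (smul A) (smul B) f \<and>
     (\<forall>x y z. f (brk A x y z) = brk B (f x) (f y) (f z)) \<and>
     f \<circ> rbop A = rbop B \<circ> f"

definition trivial_RB3 ::
    "('k \<Rightarrow> 'm \<Rightarrow> 'm) \<Rightarrow> ('m \<Rightarrow> 'm) \<Rightarrow> ('k, 'm::ab_group_add) rb3" where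
  "trivial_RB3 sm TM = \<lparr>smul = sm, brk = (\<lambda>_ _ _. 0), rbop = TM\<rparr>"


section \<open>Representations\<close>

definition three_Lie_representation ::
    "('k::field, 'g::ab_group_add) rb3 \<Rightarrow> ('k \<Rightarrow> 'm::ab_group_add \<Rightarrow> 'm)
      \<Rightarrow> ('g \<Rightarrow> 'g \<Rightarrow> 'm \<Rightarrow> 'm) \<Rightarrow> bool" where
  "three_Lie_representation G sm \<rho> \<longleftrightarrow>
     vector_space sm \<and>
     (\<forall>x y. Vector_Spaces.linear sm sm (\<rho> x y)) \<and>
     (\<forall>m. alternating_bilinear (smul G) sm (\<lambda>x y. \<rho> x y m)) \<and>
     (\<forall>x1 x2 x3 x4.
        \<rho> x1 x2 \<circ> \<rho> x3 x4 =
          \<rho> (brk G x1 x2 x3) x4 + \<rho> x3 (brk G x1 x2 x4) + (\<rho> x3 x4 \<circ> \<rho> x1 x2)) \<and>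
     (\<forall>x1 x2 x3 x4.
        \<rho> x1 (brk G x2 x3 x4) =
          (\<rho> x3 x4 \<circ> \<rho> x1 x2) - (\<rho> x2 x4 \<circ> \<rho> x1 x3) + (\<rho> x2 x3 \<circ> \<rho> x1 x4))"

definition RB3_representation ::
    "'k::field \<Rightarrow> ('k, 'g::ab_group_add) rb3 \<Rightarrow> ('k \<Rightarrow> 'm::ab_group_add \<Rightarrow> 'm) \<Rightarrow> ('m \<Rightarrow> 'm)
      \<Rightarrow> ('g \<Rightarrow> 'g \<Rightarrow> 'm \<Rightarrow> 'm) \<Rightarrow> bool" where
  "RB3_representation lam G sm TM \<rho> \<longleftrightarrow>
     three_Lie_representation G sm \<rho> \<and>
     Vector_Spaces.linear sm sm TM \<and>
     (\<forall>x y m. let T = rbop G in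
        \<rho> (T x) (T y) (TM m) =
          TM (\<rho> (T x) (T y) m + \<rho> (T x) y (TM m) + \<rho> x (T y) (TM m)
            + sm lam (\<rho> (T x) y m) + sm lam (\<rho> x (T y) m) + sm lam (\<rho> x y (TM m))
            + sm (lam\<^sup>2) (\<rho> x y m)))"


section \<open>The second cohomology group\<close>

definition rhoT ::
    "'k::field \<Rightarrow> ('k, 'g::ab_group_add) rb3 \<Rightarrow> ('k \<Rightarrow> 'm::ab_group_add \<Rightarrow> 'm) \<Rightarrow> ('m \<Rightarrow> 'm)
      \<Rightarrow> ('g \<Rightarrow> 'g \<Rightarrow> 'm \<Rightarrow> 'm) \<Rightarrow> 'g \<Rightarrow> 'g \<Rightarrow> 'm \<Rightarrow> 'm" where
  "rhoT lam G sm TM \<rho> x y m =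
     (let T = rbop G in
       \<rho> (T x) (T y) m - TM (\<rho> (T x) y m + \<rho> x (T y) m + sm lam (\<rho> x y m)))"

definition delta1 ::
    "('k, 'g) rb3 \<Rightarrow> ('g \<Rightarrow> 'g \<Rightarrow> 'm::ab_group_add \<Rightarrow> 'm) \<Rightarrow> ('g \<Rightarrow> 'm)
      \<Rightarrow> 'g \<Rightarrow> 'g \<Rightarrow> 'g \<Rightarrow> 'm" where
  "delta1 G \<rho> f x y z = - f (brk G x y z) + \<rho> x y (f z) + \<rho> y z (f x) + \<rho> z x (f y)"

definition Phi1 :: "('k, 'g) rb3 \<Rightarrow> ('m::ab_group_add \<Rightarrow> 'm) \<Rightarrow> ('g \<Rightarrow> 'm) \<Rightarrow> 'g \<Rightarrow> 'm" where
  "Phi1 G TM f = (f \<circ> rbop G) - (TM \<circ> f)"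

definition delta2 ::
    "('k, 'g) rb3 \<Rightarrow> ('g \<Rightarrow> 'g \<Rightarrow> 'm::ab_group_add \<Rightarrow> 'm) \<Rightarrow> ('g \<Rightarrow> 'g \<Rightarrow> 'g \<Rightarrow> 'm)
      \<Rightarrow> 'g \<Rightarrow> 'g \<Rightarrow> 'g \<Rightarrow> 'g \<Rightarrow> 'g \<Rightarrow> 'm" where
  "delta2 G \<rho> f x1 x2 x3 x4 x5 =
     - f (brk G x1 x2 x3) x4 x5 - f x3 (brk G x1 x2 x4) x5 - f x3 x4 (brk G x1 x2 x5)
     + f x1 x2 (brk G x3 x4 x5)
     + \<rho> x1 x2 (f x3 x4 x5) - \<rho> x3 x4 (f x1 x2 x5)
     - \<rho> x4 x5 (f x1 x2 x3) - \<rho> x5 x3 (f x1 x2 x4)"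

definition partial1 ::
    "'k::field \<Rightarrow> ('k, 'g::ab_group_add) rb3 \<Rightarrow> ('k \<Rightarrow> 'm::ab_group_add \<Rightarrow> 'm) \<Rightarrow> ('m \<Rightarrow> 'm)
      \<Rightarrow> ('g \<Rightarrow> 'g \<Rightarrow> 'm \<Rightarrow> 'm) \<Rightarrow> ('g \<Rightarrow> 'm) \<Rightarrow> 'g \<Rightarrow> 'g \<Rightarrow> 'g \<Rightarrow> 'm" where
  "partial1 lam G sm TM \<rho> g x y z =
     - g (brkT lam G x y z) + rhoT lam G sm TM \<rho> x y (g z)
     + rhoT lam G sm TM \<rho> y z (g x) + rhoT lam G sm TM \<rho> z x (g y)"

definition Phi2 ::
    "'k::field \<Rightarrow> ('k, 'g::ab_group_add) rb3 \<Rightarrow> ('k \<Rightarrow> 'm::ab_group_add \<Rightarrow> 'm) \<Rightarrow> ('m \<Rightarrow> 'm)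
      \<Rightarrow> ('g \<Rightarrow> 'g \<Rightarrow> 'g \<Rightarrow> 'm) \<Rightarrow> 'g \<Rightarrow> 'g \<Rightarrow> 'g \<Rightarrow> 'm" where
  "Phi2 lam G sm TM f x y z =
     (let T = rbop G in
       f (T x) (T y) (T z)
       - TM (f (T x) (T y) z + f (T x) y (T z) + f x (T y) (T z)
           + sm lam (f (T x) y z) + sm lam (f x (T y) z) + sm lam (f x y (T z))
           + sm (lam\<^sup>2) (f x y z)))"

definition cochains1 ::
    "('k::field, 'g::ab_group_add) rb3 \<Rightarrow> ('k \<Rightarrow> 'm::ab_group_add \<Rightarrow> 'm)
      \<Rightarrow> (('g \<Rightarrow> 'm) \<times> 'm) set" where
  "cochains1 G sm = {f. Vector_Spaces.linear (smul G) sm f} \<times> UNIV"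

definition cochains2 ::
    "('k::field, 'g::ab_group_add) rb3 \<Rightarrow> ('k \<Rightarrow> 'm::ab_group_add \<Rightarrow> 'm)
      \<Rightarrow> (('g \<Rightarrow> 'g \<Rightarrow> 'g \<Rightarrow> 'm) \<times> ('g \<Rightarrow> 'm)) set" where
  "cochains2 G sm =
     {f. alternating_trilinear (smul G) sm f} \<times> {g. Vector_Spaces.linear (smul G) sm g}"

text \<open>
  The degree-0 coboundary \<open>\<delta>\<^sup>0 : M \<rightarrow> Hom(g, M)\<close> of the 3-Lie algebra complex enters \<open>d\<^sup>1\<close> only
  through the relations \<open>\<delta>\<^sup>1 \<circ> \<delta>\<^sup>0 = 0\<close> and \<open>\<partial>\<^sup>0 = \<Phi>\<^sup>1 \<circ> \<delta>\<^sup>0\<close>.  It is kept as a parameter \<open>d0\<close>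
  constrained by \<open>degree0_coboundary\<close>, and \<open>\<partial>\<^sup>0\<close> is written as \<open>\<Phi>\<^sup>1 \<circ> \<delta>\<^sup>0\<close>.
  The image of \<open>d\<^sup>1\<close>, and hence the cohomology group, does not depend on the choice of \<open>d0\<close>.
\<close>

definition degree0_coboundary ::
    "('k::field, 'g::ab_group_add) rb3 \<Rightarrow> ('k \<Rightarrow> 'm::ab_group_add \<Rightarrow> 'm)
      \<Rightarrow> ('g \<Rightarrow> 'g \<Rightarrow> 'm \<Rightarrow> 'm) \<Rightarrow> ('m \<Rightarrow> 'g \<Rightarrow> 'm) \<Rightarrow> bool" where
  "degree0_coboundary G sm \<rho> d0 \<longleftrightarrow>
     (\<forall>a. Vector_Spaces.linear (smul G) sm (d0 a)) \<and>
     (\<forall>x. Vector_Spaces.linear sm sm (\<lambda>a. d0 a x)) \<and>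
     (\<forall>a. delta1 G \<rho> (d0 a) = 0)"

definition diff1 ::
    "('k, 'g) rb3 \<Rightarrow> ('m::ab_group_add \<Rightarrow> 'm) \<Rightarrow> ('g \<Rightarrow> 'g \<Rightarrow> 'm \<Rightarrow> 'm) \<Rightarrow> ('m \<Rightarrow> 'g \<Rightarrow> 'm)
      \<Rightarrow> ('g \<Rightarrow> 'm) \<times> 'm \<Rightarrow> ('g \<Rightarrow> 'g \<Rightarrow> 'g \<Rightarrow> 'm) \<times> ('g \<Rightarrow> 'm)" where
  "diff1 G TM \<rho> d0 = (\<lambda>(f, a). (delta1 G \<rho> f, - Phi1 G TM (d0 a) - Phi1 G TM f))"

definition diff2 ::
    "'k::field \<Rightarrow> ('k, 'g::ab_group_add) rb3 \<Rightarrow> ('k \<Rightarrow> 'm::ab_group_add \<Rightarrow> 'm) \<Rightarrow> ('m \<Rightarrow> 'm)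
      \<Rightarrow> ('g \<Rightarrow> 'g \<Rightarrow> 'm \<Rightarrow> 'm) \<Rightarrow> ('g \<Rightarrow> 'g \<Rightarrow> 'g \<Rightarrow> 'm) \<times> ('g \<Rightarrow> 'm)
      \<Rightarrow> ('g \<Rightarrow> 'g \<Rightarrow> 'g \<Rightarrow> 'g \<Rightarrow> 'g \<Rightarrow> 'm) \<times> ('g \<Rightarrow> 'g \<Rightarrow> 'g \<Rightarrow> 'm)" where
  "diff2 lam G sm TM \<rho> =
     (\<lambda>(f, g). (delta2 G \<rho> f, - partial1 lam G sm TM \<rho> g - Phi2 lam G sm TM f))"

definition cocycles2 ::
    "'k::field \<Rightarrow> ('k, 'g::ab_group_add) rb3 \<Rightarrow> ('k \<Rightarrow> 'm::ab_group_add \<Rightarrow> 'm) \<Rightarrow> ('m \<Rightarrow> 'm)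
      \<Rightarrow> ('g \<Rightarrow> 'g \<Rightarrow> 'm \<Rightarrow> 'm) \<Rightarrow> (('g \<Rightarrow> 'g \<Rightarrow> 'g \<Rightarrow> 'm) \<times> ('g \<Rightarrow> 'm)) set" where
  "cocycles2 lam G sm TM \<rho> = {c \<in> cochains2 G sm. diff2 lam G sm TM \<rho> c = 0}"

definition coboundaries2 ::
    "('k::field, 'g::ab_group_add) rb3 \<Rightarrow> ('k \<Rightarrow> 'm::ab_group_add \<Rightarrow> 'm) \<Rightarrow> ('m \<Rightarrow> 'm)
      \<Rightarrow> ('g \<Rightarrow> 'g \<Rightarrow> 'm \<Rightarrow> 'm) \<Rightarrow> ('m \<Rightarrow> 'g \<Rightarrow> 'm)
      \<Rightarrow> (('g \<Rightarrow> 'g \<Rightarrow> 'g \<Rightarrow> 'm) \<times> ('g \<Rightarrow> 'm)) set" where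
  "coboundaries2 G sm TM \<rho> d0 = diff1 G TM \<rho> d0 ` cochains1 G sm"

text \<open>The quotient is the set of cosets \<open>c +o B\<close>.\<close>

definition H2 ::
    "'k::field \<Rightarrow> ('k, 'g::ab_group_add) rb3 \<Rightarrow> ('k \<Rightarrow> 'm::ab_group_add \<Rightarrow> 'm) \<Rightarrow> ('m \<Rightarrow> 'm)
      \<Rightarrow> ('g \<Rightarrow> 'g \<Rightarrow> 'm \<Rightarrow> 'm) \<Rightarrow> ('m \<Rightarrow> 'g \<Rightarrow> 'm)
      \<Rightarrow> (('g \<Rightarrow> 'g \<Rightarrow> 'g \<Rightarrow> 'm) \<times> ('g \<Rightarrow> 'm)) set set" where
  "H2 lam G sm TM \<rho> d0 =
     (\<lambda>c. c +o coboundaries2 G sm TM \<rho> d0) ` cocycles2 lam G sm TM \<rho>"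


section \<open>Abelian extensions\<close>

definition abelian_extension ::
    "'k::field \<Rightarrow> ('k, 'm::ab_group_add) rb3 \<Rightarrow> ('k, 'e::ab_group_add) rb3
      \<Rightarrow> ('k, 'g::ab_group_add) rb3 \<Rightarrow> ('m \<Rightarrow> 'e) \<Rightarrow> ('e \<Rightarrow> 'g) \<Rightarrow> bool" where
  "abelian_extension lam M E G i p \<longleftrightarrow>
     RB3_Lie_algebra lam M \<and> RB3_Lie_algebra lam E \<and> RB3_Lie_algebra lam G \<and>
     RB3_hom M E i \<and> RB3_hom E G p \<and>
     inj i \<and> range i = {u. p u = 0} \<and> surj p \<and>
     (\<forall>u m n. brk E u (i m) (i n) = 0)"

definition isomorphic_extensions ::
    "('k::field, 'e::ab_group_add) rb3 \<Rightarrow> ('m \<Rightarrow> 'e) \<Rightarrow> ('e \<Rightarrow> 'g)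
      \<Rightarrow> ('k, 'h::ab_group_add) rb3 \<Rightarrow> ('m \<Rightarrow> 'h) \<Rightarrow> ('h \<Rightarrow> 'g) \<Rightarrow> bool" where
  "isomorphic_extensions E1 i1 p1 E2 i2 p2 \<longleftrightarrow>
     (\<exists>\<zeta>. RB3_hom E1 E2 \<zeta> \<and> bij \<zeta> \<and> \<zeta> \<circ> i1 = i2 \<and> p2 \<circ> \<zeta> = p1)"

definition ext_section ::
    "('k::field, 'e::ab_group_add) rb3 \<Rightarrow> ('k, 'g::ab_group_add) rb3 \<Rightarrow> ('e \<Rightarrow> 'g)
      \<Rightarrow> ('g \<Rightarrow> 'e) \<Rightarrow> bool" where
  "ext_section E G p s \<longleftrightarrow> Vector_Spaces.linear (smul G) (smul E) s \<and> p \<circ> s = id"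

text \<open>
  The identification of \<open>M\<close> with \<open>i(M)\<close> is made explicit by \<^term>\<open>inv i\<close>; in an abelian
  extension with section \<open>s\<close> the arguments of \<^term>\<open>inv i\<close> below all lie in the range of \<open>i\<close>.
\<close>

definition ext_rho ::
    "('k, 'e) rb3 \<Rightarrow> ('m \<Rightarrow> 'e) \<Rightarrow> ('g \<Rightarrow> 'e) \<Rightarrow> 'g \<Rightarrow> 'g \<Rightarrow> 'm \<Rightarrow> 'm" where
  "ext_rho E i s x y m = inv i (brk E (s x) (s y) (i m))"

definition ext_psi ::
    "('k, 'e::ab_group_add) rb3 \<Rightarrow> ('k, 'g) rb3 \<Rightarrow> ('m \<Rightarrow> 'e) \<Rightarrow> ('g \<Rightarrow> 'e)
      \<Rightarrow> 'g \<Rightarrow> 'g \<Rightarrow> 'g \<Rightarrow> 'm" where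
  "ext_psi E G i s x y z = inv i (brk E (s x) (s y) (s z) - s (brk G x y z))"

definition ext_chi ::
    "('k, 'e::ab_group_add) rb3 \<Rightarrow> ('k, 'g) rb3 \<Rightarrow> ('m \<Rightarrow> 'e) \<Rightarrow> ('g \<Rightarrow> 'e) \<Rightarrow> 'g \<Rightarrow> 'm" where
  "ext_chi E G i s x = inv i (rbop E (s x) - s (rbop G x))"

text \<open>
  All actions on \<open>M\<close>, respectively all classes of \<open>(\<psi>, \<chi>)\<close> modulo coboundaries, that arise from
  some section of the extension.  That an extension gives rise to the one action \<open>\<rho>\<close> and the
  one class \<open>c\<close>, independently of the section, means that these sets are \<open>{\<rho>}\<close> and \<open>{c}\<close>.
\<close>

definition ext_actions ::
    "('k::field, 'e::ab_group_add) rb3 \<Rightarrow> ('k, 'g::ab_group_add) rb3 \<Rightarrow> ('m \<Rightarrow> 'e) \<Rightarrow> ('e \<Rightarrow> 'g)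
      \<Rightarrow> ('g \<Rightarrow> 'g \<Rightarrow> 'm \<Rightarrow> 'm) set" where
  "ext_actions E G i p = {ext_rho E i s | s. ext_section E G p s}"

definition ext_classes ::
    "('k::field, 'e::ab_group_add) rb3 \<Rightarrow> ('k, 'g::ab_group_add) rb3 \<Rightarrow> ('m \<Rightarrow> 'e) \<Rightarrow> ('e \<Rightarrow> 'g)
      \<Rightarrow> ('k \<Rightarrow> 'm::ab_group_add \<Rightarrow> 'm) \<Rightarrow> ('m \<Rightarrow> 'm) \<Rightarrow> ('g \<Rightarrow> 'g \<Rightarrow> 'm \<Rightarrow> 'm)
      \<Rightarrow> ('m \<Rightarrow> 'g \<Rightarrow> 'm) \<Rightarrow> (('g \<Rightarrow> 'g \<Rightarrow> 'g \<Rightarrow> 'm) \<times> ('g \<Rightarrow> 'm)) set set" where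
  "ext_classes E G i p sm TM \<rho> d0 =
     {(ext_psi E G i s, ext_chi E G i s) +o coboundaries2 G sm TM \<rho> d0 | s. ext_section E G p s}"

end

theory Submission
  imports Defs
begin

text \<open>
  Relative to a section \<open>s\<close>, the bracket and the operator of the extension are
  \<open>[s x, s y, s z] = s [x, y, z] + i (\<psi> x y z)\<close>, \<open>[s x, s y, i m] = i (\<rho> x y m)\<close> and
  \<open>T (s x) = s (T x) + i (\<chi> x)\<close>, brackets with two arguments in \<open>i(M)\<close> being zero.  Comparing the
  \<open>i\<close>-components of the axioms of the extension gives the representation and cocycle identities.
  Two sections differ by \<open>i \<circ> f\<close> with \<open>f\<close> linear, which leaves \<open>\<rho>\<close> unchanged and adds
  \<open>(\<delta>\<^sup>1 f, - \<Phi>\<^sup>1 f)\<close> to \<open>(\<psi>, \<chi>)\<close>.  An isomorphism of extensions \<open>\<zeta>\<close> carries \<open>s\<close> to a section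
  \<open>\<zeta> \<circ> s\<close> with literally the same \<open>\<rho>\<close>, \<open>\<psi>\<close> and \<open>\<chi>\<close>.
\<close>

section \<open>Rewrite rules for linear and multilinear maps\<close>

lemma linear_simps:
  assumes "Vector_Spaces.linear sv sw f"
  shows "f (x + y) = f x + f y" "f (x - y) = f x - f y" "f (- x) = - f x" "f 0 = 0"
    "f (sv c x) = sw c (f x)"
proof -
  interpret module_hom sv sw f
    using assms by (simp add: linear_iff_module_hom)
  show "f (x + y) = f x + f y" "f (x - y) = f x - f y" "f (- x) = - f x" "f 0 = 0"
    "f (sv c x) = sw c (f x)"
    by (simp_all add: add diff neg scale)
qed

lemma vector_space_simps:
  assumes "vector_space sv"
  shows "sv c (x + y) = sv c x + sv c y" "sv c (x - y) = sv c x - sv c y"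
    "sv c (- x) = - sv c x" "sv c 0 = 0"
proof -
  interpret vector_space sv by (fact assms)
  show "sv c (x + y) = sv c x + sv c y" "sv c (x - y) = sv c x - sv c y"
    "sv c (- x) = - sv c x" "sv c 0 = 0"
    by (simp_all add: scale_right_distrib scale_right_diff_distrib)
qed

lemma alternating_trilinear_simps:
  assumes "alternating_trilinear sv sw f"
  shows "f (x + x') y z = f x y z + f x' y z"
    "f x (y + y') z = f x y z + f x y' z"
    "f x y (z + z') = f x y z + f x y z'"
    "f (- x) y z = - f x y z"
    "f x (- y) z = - f x y z"
    "f x y (- z) = - f x y z"
    "f (sv c x) y z = sw c (f x y z)"
    "f x (sv c y) z = sw c (f x y z)"
    "f x y (sv c z) = sw c (f x y z)"
    "f 0 y z = 0" "f x 0 z = 0" "f x y 0 = 0"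
    "f x x z = 0" "f x z z = 0" "f x z x = 0"
proof -
  have lin: "Vector_Spaces.linear sv sw (\<lambda>x. f x y z)" "Vector_Spaces.linear sv sw (\<lambda>y. f x y z)"
    "Vector_Spaces.linear sv sw (\<lambda>z. f x y z)" for x y z
    using assms by (auto simp: alternating_trilinear_def)
  note simps = linear_simps[OF lin(1)] linear_simps[OF lin(2)] linear_simps[OF lin(3)]
  show "f (x + x') y z = f x y z + f x' y z"
    "f x (y + y') z = f x y z + f x y' z"
    "f x y (z + z') = f x y z + f x y z'"
    "f (- x) y z = - f x y z"
    "f x (- y) z = - f x y z"
    "f x y (- z) = - f x y z"
    "f (sv c x) y z = sw c (f x y z)"
    "f x (sv c y) z = sw c (f x y z)"
    "f x y (sv c z) = sw c (f x y z)"
    "f 0 y z = 0" "f x 0 z = 0" "f x y 0 = 0"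
    by (rule simps)+
  show "f x x z = 0" "f x z z = 0" "f x z x = 0"
    using assms by (auto simp: alternating_trilinear_def)
qed

text \<open>Polarization: expanding \<open>f\<close> at a repeated argument \<open>x + y\<close> or
  \<open>y + z\<close> leaves only the two mixed terms, whose sum must vanish.\<close>

lemma alternating_trilinear_swap:
  assumes "alternating_trilinear sv sw f"
  shows "f y x z = - f x y z" "f x z y = - f x y z"
proof -
  note simps = alternating_trilinear_simps[OF assms]
  have "f (x + y) (x + y) z = 0" "f x (y + z) (y + z) = 0"
    by (rule simps(13), rule simps(14))
  then have "f x y z + f y x z = 0" "f x y z + f x z y = 0"
    unfolding simps(1-3) by (simp_all add: simps(13,14) add.commute)
  then show "f y x z = - f x y z" "f x z y = - f x y z"
    by (simp_all add: eq_neg_iff_add_eq_0 add.commute)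
qed

text \<open>With zero bracket every identity is trivial; the Rota-Baxter one reduces to
  \<open>TM 0 = 0\<close>.\<close>

lemma trivial_RB3_Lie_algebra:
  assumes "vector_space sm" "Vector_Spaces.linear sm sm TM"
  shows "RB3_Lie_algebra lam (trivial_RB3 sm TM)"
  using assms linear_simps(4)[OF assms(2)]
  by (auto simp: RB3_Lie_algebra_def trivial_RB3_def three_Lie_algebra_def brkT_def
      alternating_trilinear_def Vector_Spaces.linear_iff vector_space_simps)

section \<open>The subgroup of coboundaries and its cosets\<close>

lemma mem_coboundaries2:
  assumes "Vector_Spaces.linear sm sm TM" "degree0_coboundary G sm \<rho> d0"
    and "Vector_Spaces.linear (smul G) sm f"
  shows "(delta1 G \<rho> f, - Phi1 G TM f) \<in> coboundaries2 G sm TM \<rho> d0"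
proof -
  \<comment> \<open>The preimage will be \<open>(f, 0)\<close>: linearity of \<open>d0\<close> in
    its first argument removes the degree-0 contribution from \<open>diff1\<close>.\<close>
  have "d0 0 x = 0" for x
    using assms(2) linear_simps(4)[of sm sm "\<lambda>a. d0 a x"] by (simp add: degree0_coboundary_def)
  then have "diff1 G TM \<rho> d0 (f, 0) = (delta1 G \<rho> f, - Phi1 G TM f)"
    by (simp add: diff1_def Phi1_def fun_eq_iff linear_simps[OF assms(1)])
  then show ?thesis
    using assms(3) imageI[of "(f, 0)" "cochains1 G sm" "diff1 G TM \<rho> d0"]
    by (simp add: coboundaries2_def cochains1_def)
qed

lemma diff1_diff:
  assumes "three_Lie_representation G sm \<rho>" "Vector_Spaces.linear sm sm TM"
    and "degree0_coboundary G sm \<rho> d0"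
  shows "diff1 G TM \<rho> d0 (u - v) = diff1 G TM \<rho> d0 u - diff1 G TM \<rho> d0 v"
proof -
  have "d0 (a - b) x = d0 a x - d0 b x" for a b x
    using assms(3) linear_simps(2)[of sm sm "\<lambda>a. d0 a x"] by (simp add: degree0_coboundary_def)
  moreover have "\<rho> x y (m - n) = \<rho> x y m - \<rho> x y n" for x y m n
    using assms(1) linear_simps(2)[of sm sm "\<rho> x y"] by (simp add: three_Lie_representation_def)
  ultimately show ?thesis
    by (cases u; cases v) (simp add: diff1_def delta1_def Phi1_def fun_eq_iff linear_simps[OF assms(2)])
qed

lemma coboundaries2_diff:
  assumes "three_Lie_representation G sm \<rho>" "Vector_Spaces.linear sm sm TM"
    and "degree0_coboundary G sm \<rho> d0"
    and "c \<in> coboundaries2 G sm TM \<rho> d0" "c' \<in> coboundaries2 G sm TM \<rho> d0"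
  shows "c - c' \<in> coboundaries2 G sm TM \<rho> d0"
proof -
  have "u - v \<in> cochains1 G sm" if "u \<in> cochains1 G sm" "v \<in> cochains1 G sm" for u v
    using that by (auto simp: cochains1_def Vector_Spaces.linear_iff vector_space_simps)
  with assms(4,5) show ?thesis
    unfolding coboundaries2_def by (auto simp flip: diff1_diff[OF assms(1-3)])
qed

text \<open>Closure under differences gives closure under negation and addition, so a coboundary can
  be moved from the representative into the subgroup.\<close>

lemma coboundaries2_coset_eqI:
  assumes "three_Lie_representation G sm \<rho>" "Vector_Spaces.linear sm sm TM"
    and "degree0_coboundary G sm \<rho> d0" and "c - c' \<in> coboundaries2 G sm TM \<rho> d0"
  shows "c +o coboundaries2 G sm TM \<rho> d0 = c' +o coboundaries2 G sm TM \<rho> d0"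
proof -
  let ?B = "coboundaries2 G sm TM \<rho> d0"
  note diff = coboundaries2_diff[OF assms(1-3)]
  have uminus: "- b \<in> ?B" if "b \<in> ?B" for b
    using diff[OF diff[OF that that] that] by simp
  have add: "a + b \<in> ?B" if "a \<in> ?B" "b \<in> ?B" for a b
    using diff[OF that(1) uminus[OF that(2)]] by simp
  have "d +o ?B \<subseteq> d' +o ?B" if "d - d' \<in> ?B" for d d'
  proof
    fix x assume "x \<in> d +o ?B"
    then obtain b where "b \<in> ?B" "x = d + b"
      unfolding elt_set_plus_def by blast
    moreover have "d + b = d' + ((d - d') + b)"
      by simp
    ultimately show "x \<in> d' +o ?B"
      using add[OF that] unfolding elt_set_plus_def by blast
  qed
  from this[OF assms(4)] this[of c' c] show ?thesis
    using uminus[OF assms(4)] by auto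
qed

section \<open>Structure of a single abelian extension\<close>

locale abelian_RB3_extension =
  fixes lam :: "'k::field" and sm :: "'k \<Rightarrow> 'm::ab_group_add \<Rightarrow> 'm" and TM :: "'m \<Rightarrow> 'm"
    and E :: "('k, 'e::ab_group_add) rb3" and G :: "('k, 'g::ab_group_add) rb3"
    and i :: "'m \<Rightarrow> 'e" and p :: "'e \<Rightarrow> 'g"
  assumes extension: "abelian_extension lam (trivial_RB3 sm TM) E G i p"
begin

lemma RB3_E: "RB3_Lie_algebra lam E" and RB3_G: "RB3_Lie_algebra lam G"
  and RB3_M: "RB3_Lie_algebra lam (trivial_RB3 sm TM)"
  using extension by (simp_all add: abelian_extension_def)

lemma vs_E: "vector_space (smul E)" and vs_G: "vector_space (smul G)" and vs_M: "vector_space sm"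
  using RB3_E RB3_G RB3_M
  by (simp_all add: RB3_Lie_algebra_def three_Lie_algebra_def trivial_RB3_def)

lemma lin_TE: "Vector_Spaces.linear (smul E) (smul E) (rbop E)"
  and lin_TG: "Vector_Spaces.linear (smul G) (smul G) (rbop G)"
  and lin_TM: "Vector_Spaces.linear sm sm TM"
  using RB3_E RB3_G RB3_M by (simp_all add: RB3_Lie_algebra_def trivial_RB3_def)

lemma tri_E: "alternating_trilinear (smul E) (smul E) (brk E)"
  and tri_G: "alternating_trilinear (smul G) (smul G) (brk G)"
  using RB3_E RB3_G by (simp_all add: RB3_Lie_algebra_def three_Lie_algebra_def)

lemma fundamental_identity_E:
  "brk E u v (brk E x y z) = brk E (brk E u v x) y z + brk E x (brk E u v y) z + brk E x y (brk E u v z)"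
  and fundamental_identity_G:
  "brk G a b (brk G c d e) = brk G (brk G a b c) d e + brk G c (brk G a b d) e + brk G c d (brk G a b e)"
  using RB3_E RB3_G unfolding RB3_Lie_algebra_def three_Lie_algebra_def by blast+

lemma Rota_Baxter_E:
  "brk E (rbop E u) (rbop E v) (rbop E w) = rbop E (brkT lam E u v w)"
  and Rota_Baxter_G:
  "brk G (rbop G x) (rbop G y) (rbop G z) = rbop G (brkT lam G x y z)"
  using RB3_E RB3_G unfolding RB3_Lie_algebra_def by blast+

lemma lin_i: "Vector_Spaces.linear sm (smul E) i"
  and lin_p: "Vector_Spaces.linear (smul E) (smul G) p"
  using extension by (simp_all add: abelian_extension_def RB3_hom_def trivial_RB3_def)

lemma rbop_i: "rbop E (i m) = i (TM m)"
  using extension by (simp add: abelian_extension_def RB3_hom_def trivial_RB3_def fun_eq_iff)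

lemma p_brk: "p (brk E u v w) = brk G (p u) (p v) (p w)"
  and p_rbop: "p (rbop E u) = rbop G (p u)"
  using extension by (simp_all add: abelian_extension_def RB3_hom_def fun_eq_iff)

lemma inj_i: "inj i" and surj_p: "surj p" and range_i: "range i = {u. p u = 0}"
  and brk_i_i: "brk E u (i m) (i n) = 0"
  using extension unfolding abelian_extension_def by blast+

lemma i_eq_iff: "i m = i n \<longleftrightarrow> m = n"
  using inj_i by (simp add: inj_eq)

lemma p_i: "p (i m) = 0"
  using range_i by blast

text \<open>Exactness at the middle term. It turns the definitions made through \<open>inv i\<close>
  into equations inside \<open>E\<close>.\<close>

lemma i_inv: "p u = 0 \<Longrightarrow> i (inv i u) = u"
  using range_i by (simp add: f_inv_into_f)

lemma brk_i_i': "brk E (i m) u (i n) = 0" "brk E (i m) (i n) u = 0"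
  using alternating_trilinear_swap[OF tri_E] brk_i_i by metis+

lemmas lin_E = vector_space_simps[OF vs_E] linear_simps[OF lin_TE] alternating_trilinear_simps[OF tri_E]
lemmas lin_G = vector_space_simps[OF vs_G] linear_simps[OF lin_TG] alternating_trilinear_simps[OF tri_G]
lemmas lin_M = vector_space_simps[OF vs_M] linear_simps[OF lin_TM]
lemmas i_simps = linear_simps[OF lin_i]
lemmas p_simps = linear_simps[OF lin_p]

text \<open>A surjective linear map of vector spaces has a linear right inverse. Without a section,
  \<open>ext_actions\<close> and \<open>ext_classes\<close> would be empty instead of
  singletons.\<close>

lemma section_exists: "\<exists>s. ext_section E G p s"
proof -
  interpret vector_space_pair "smul E" "smul G"
    using vs_E vs_G by (simp add: vector_space_pair_def)
  show ?thesis
    using linear_surj_right_inverse[OF lin_p, of UNIV UNIV] surj_p unfolding ext_section_def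
    by (simp add: fun_eq_iff)
qed

end

section \<open>Representation and cocycle attached to a section\<close>

locale split_abelian_RB3_extension = abelian_RB3_extension +
  fixes s
  assumes section_s: "ext_section E G p s"
begin

abbreviation "\<rho> \<equiv> ext_rho E i s"
abbreviation "\<psi> \<equiv> ext_psi E G i s"
abbreviation "\<chi> \<equiv> ext_chi E G i s"

lemma lin_s: "Vector_Spaces.linear (smul G) (smul E) s"
  using section_s by (simp add: ext_section_def)

lemma p_s: "p (s x) = x"
  using section_s by (simp add: ext_section_def fun_eq_iff)

lemmas s_simps = linear_simps[OF lin_s]

lemma i_rho: "i (\<rho> x y m) = brk E (s x) (s y) (i m)"
  unfolding ext_rho_def by (rule i_inv) (simp add: p_brk p_i lin_G)

lemma i_psi: "i (\<psi> x y z) = brk E (s x) (s y) (s z) - s (brk G x y z)"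
  unfolding ext_psi_def by (rule i_inv) (simp add: p_brk p_simps p_s)

lemma i_chi: "i (\<chi> x) = rbop E (s x) - s (rbop G x)"
  unfolding ext_chi_def by (rule i_inv) (simp add: p_rbop p_simps p_s)

text \<open>One transposition moves \<open>i m\<close> to the middle and its sign is absorbed by
  swapping the arguments of \<open>\<rho>\<close>; moving \<open>i m\<close> to the front is a
  cyclic rotation and costs no sign.\<close>

lemma brk_s_s_i: "brk E (s x) (s y) (i m) = i (\<rho> x y m)"
  and brk_s_i_s: "brk E (s x) (i m) (s y) = i (\<rho> y x m)"
  and brk_i_s_s: "brk E (i m) (s x) (s y) = i (\<rho> x y m)"
  using alternating_trilinear_swap[OF tri_E] by (metis i_rho)+

lemma brk_s_s_s: "brk E (s x) (s y) (s z) = s (brk G x y z) + i (\<psi> x y z)"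
  and rbop_s: "rbop E (s x) = s (rbop G x) + i (\<chi> x)"
  by (simp_all add: i_psi i_chi)

text \<open>The multiplication table of the extension: values on \<open>s\<close>- and
  \<open>i\<close>-elements are split into an \<open>s\<close>-part and an
  \<open>i\<close>-part.\<close>

lemmas brk_rules = brk_s_s_i brk_s_i_s brk_i_s_s brk_s_s_s rbop_s rbop_i brk_i_i brk_i_i'

text \<open>As \<open>i\<close> is injective, identities in \<open>M\<close> can be tested after
  applying \<open>i\<close>, where they become properties of the bracket of
  \<open>E\<close>.\<close>

lemma lin_rho: "Vector_Spaces.linear sm sm (\<rho> x y)"
  using vs_M by (simp add: Vector_Spaces.linear_iff i_eq_iff[symmetric] i_simps i_rho lin_E)

lemma bilinear_rho: "alternating_bilinear (smul G) sm (\<lambda>x y. \<rho> x y m)"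
  using vs_M vs_G
  by (simp add: alternating_bilinear_def Vector_Spaces.linear_iff i_eq_iff[symmetric] i_simps i_rho lin_E s_simps)

lemmas rho_simps = linear_simps[OF lin_rho]

lemma rho_swap: "\<rho> y x m = - \<rho> x y m"
  by (simp add: i_eq_iff[symmetric] i_simps i_rho alternating_trilinear_swap(1)[OF tri_E, of "s x"])

text \<open>Both identities are the fundamental identity of \<open>E\<close> at four section values
  and one \<open>i m\<close>, placed last for the first identity and second for the other. The
  \<open>\<psi>\<close>-terms meet another element of \<open>i(M)\<close> and vanish.\<close>

lemma three_Lie_representation_rho: "three_Lie_representation G sm \<rho>"
proof -
  have "\<rho> x1 x2 (\<rho> x3 x4 m) = \<rho> (brk G x1 x2 x3) x4 m + \<rho> x3 (brk G x1 x2 x4) m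
      + \<rho> x3 x4 (\<rho> x1 x2 m)" for x1 x2 x3 x4 m
    using fundamental_identity_E[of "s x1" "s x2" "s x3" "s x4" "i m"]
    by (simp add: brk_rules lin_E i_simps[symmetric] i_eq_iff)
  moreover have "\<rho> x1 (brk G x2 x3 x4) m = \<rho> x3 x4 (\<rho> x1 x2 m) - \<rho> x2 x4 (\<rho> x1 x3 m)
      + \<rho> x2 x3 (\<rho> x1 x4 m)" for x1 x2 x3 x4 m
  proof -
    \<comment> \<open>Each term carries one factor \<open>\<rho> _ x1\<close>, whose swap changes
      its sign; the middle summand changes sign again through \<open>\<rho> x4 x2\<close>. The
      outcome is the negated identity.\<close>
    have "- \<rho> x1 (brk G x2 x3 x4) m
        = - \<rho> x3 x4 (\<rho> x1 x2 m) + \<rho> x2 x4 (\<rho> x1 x3 m) + - \<rho> x2 x3 (\<rho> x1 x4 m)"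
      using fundamental_identity_E[of "s x1" "i m" "s x2" "s x3" "s x4"]
      by (simp add: brk_rules lin_E i_simps[symmetric] i_eq_iff rho_simps
          rho_swap[of _ x1] rho_swap[of x4 x2] del: add_uminus_conv_diff)
    then have "- (- \<rho> x1 (brk G x2 x3 x4) m)
        = - (- \<rho> x3 x4 (\<rho> x1 x2 m) + \<rho> x2 x4 (\<rho> x1 x3 m) + - \<rho> x2 x3 (\<rho> x1 x4 m))"
      by (rule arg_cong)
    then show ?thesis
      by simp
  qed
  ultimately show ?thesis
    using vs_M lin_rho bilinear_rho by (simp add: three_Lie_representation_def fun_eq_iff)
qed

text \<open>This is the Rota-Baxter identity of \<open>E\<close> at \<open>s x\<close>,
  \<open>s y\<close>, \<open>i m\<close>; the \<open>\<chi>\<close>-terms vanish because they meet a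
  second element of \<open>i(M)\<close>.\<close>

lemma RB3_representation_rho: "RB3_representation lam G sm TM \<rho>"
proof -
  have "\<rho> (rbop G x) (rbop G y) (TM m) =
          TM (\<rho> (rbop G x) (rbop G y) m + \<rho> (rbop G x) y (TM m) + \<rho> x (rbop G y) (TM m)
            + sm lam (\<rho> (rbop G x) y m) + sm lam (\<rho> x (rbop G y) m) + sm lam (\<rho> x y (TM m))
            + sm (lam\<^sup>2) (\<rho> x y m))" for x y m
    using Rota_Baxter_E[of "s x" "s y" "i m"]
    by (simp add: brkT_def brk_rules lin_E lin_M i_simps[symmetric] i_eq_iff)
  then show ?thesis
    using three_Lie_representation_rho lin_TM by (simp add: RB3_representation_def Let_def)
qed

lemma cochain: "(\<psi>, \<chi>) \<in> cochains2 G sm"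
  using vs_M vs_G
  by (simp add: cochains2_def alternating_trilinear_def Vector_Spaces.linear_iff i_eq_iff[symmetric]
      i_simps i_psi i_chi lin_E lin_G s_simps)

lemma delta2_psi: "delta2 G \<rho> \<psi> x1 x2 x3 x4 x5 = 0"
proof -
  \<comment> \<open>the \<open>i\<close>- and \<open>s\<close>-components of the right-hand side of the fundamental identity\<close>
  define R where "R = \<psi> (brk G x1 x2 x3) x4 x5 + \<psi> x3 (brk G x1 x2 x4) x5
    + \<psi> x3 x4 (brk G x1 x2 x5)
    + \<rho> x4 x5 (\<psi> x1 x2 x3) + \<rho> x5 x3 (\<psi> x1 x2 x4) + \<rho> x3 x4 (\<psi> x1 x2 x5)"
  define S where "S = s (brk G (brk G x1 x2 x3) x4 x5)
    + s (brk G x3 (brk G x1 x2 x4) x5) + s (brk G x3 x4 (brk G x1 x2 x5))"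
  have "brk E (s x1) (s x2) (brk E (s x3) (s x4) (s x5))
      = s (brk G x1 x2 (brk G x3 x4 x5)) + i (\<psi> x1 x2 (brk G x3 x4 x5) + \<rho> x1 x2 (\<psi> x3 x4 x5))"
    by (simp add: brk_rules lin_E i_simps ac_simps)
  \<comment> \<open>The \<open>s\<close>-components of the two sides agree by the fundamental
    identity of \<open>G\<close>, so cancelling \<open>S\<close> leaves an equation between
    \<open>i\<close>-components.\<close>
  moreover have "s (brk G x1 x2 (brk G x3 x4 x5)) = S"
    unfolding S_def by (subst fundamental_identity_G) (simp add: s_simps)
  moreover have "brk E (brk E (s x1) (s x2) (s x3)) (s x4) (s x5)
      + brk E (s x3) (brk E (s x1) (s x2) (s x4)) (s x5)
      + brk E (s x3) (s x4) (brk E (s x1) (s x2) (s x5)) = S + i R"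
    by (simp add: R_def S_def brk_rules lin_E i_simps ac_simps)
  ultimately have "i (\<psi> x1 x2 (brk G x3 x4 x5) + \<rho> x1 x2 (\<psi> x3 x4 x5)) = i R"
    using fundamental_identity_E[of "s x1" "s x2" "s x3" "s x4" "s x5"] by simp
  then have "\<psi> x1 x2 (brk G x3 x4 x5) = R - \<rho> x1 x2 (\<psi> x3 x4 x5)"
    by (simp add: i_eq_iff eq_diff_eq)
  then show ?thesis
    by (simp add: delta2_def R_def)
qed

lemma partial1_chi: "partial1 lam G sm TM \<rho> \<chi> x y z + Phi2 lam G sm TM \<psi> x y z = 0"
proof -
  let ?T = "rbop G"
  \<comment> \<open>the \<open>i\<close>-components of \<open>[T (s x), T (s y), T (s z)]\<close> and of \<open>[s x, s y, s z]\<^sub>T\<close>\<close>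
  define L where "L = \<psi> (?T x) (?T y) (?T z)
    + \<rho> (?T x) (?T y) (\<chi> z) + \<rho> (?T y) (?T z) (\<chi> x) + \<rho> (?T z) (?T x) (\<chi> y)"
  define N where "N =
    \<psi> (?T x) (?T y) z + \<psi> (?T x) y (?T z) + \<psi> x (?T y) (?T z)
    + sm lam (\<psi> (?T x) y z) + sm lam (\<psi> x (?T y) z) + sm lam (\<psi> x y (?T z))
    + sm (lam\<^sup>2) (\<psi> x y z)
    + \<rho> (?T x) y (\<chi> z) + \<rho> x (?T y) (\<chi> z) + sm lam (\<rho> x y (\<chi> z))
    + \<rho> (?T y) z (\<chi> x) + \<rho> y (?T z) (\<chi> x) + sm lam (\<rho> y z (\<chi> x))
    + \<rho> (?T z) x (\<chi> y) + \<rho> z (?T x) (\<chi> y) + sm lam (\<rho> z x (\<chi> y))"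
  have "brk E (rbop E (s x)) (rbop E (s y)) (rbop E (s z)) = s (brk G (?T x) (?T y) (?T z)) + i L"
    by (simp add: L_def brk_rules lin_E i_simps ac_simps)
  moreover have "brkT lam E (s x) (s y) (s z) = s (brkT lam G x y z) + i N"
    by (simp only: N_def brkT_def Let_def brk_rules lin_E i_simps s_simps add_0_left add_0_right ac_simps)
  \<comment> \<open>Applying \<open>rbop E\<close> to \<open>s (brkT lam G x y z) + i N\<close>
    produces a further \<open>\<chi>\<close>-term; the Rota-Baxter identity of \<open>G\<close> then
    cancels the \<open>s\<close>-components.\<close>
  ultimately have "i L = i (\<chi> (brkT lam G x y z) + TM N)"
    using Rota_Baxter_E[of "s x" "s y" "s z"] by (simp add: Rota_Baxter_G lin_E i_simps brk_rules add.assoc)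
  then have "\<chi> (brkT lam G x y z) = L - TM N"
    by (simp add: i_eq_iff)
  \<comment> \<open>The \<open>\<rho>\<close>-terms of \<open>L\<close> and of \<open>TM N\<close>
    combine cyclically into the three \<open>rhoT\<close>-terms, and the \<open>\<psi>\<close>-terms
    into \<open>Phi2\<close>.\<close>
  moreover have "partial1 lam G sm TM \<rho> \<chi> x y z + Phi2 lam G sm TM \<psi> x y z
      = L - TM N - \<chi> (brkT lam G x y z)"
    by (simp add: partial1_def rhoT_def Phi2_def Let_def L_def N_def lin_M algebra_simps)
  ultimately show ?thesis
    by simp
qed

lemma cocycle: "(\<psi>, \<chi>) \<in> cocycles2 lam G sm TM \<rho>"
proof -
  have "- partial1 lam G sm TM \<rho> \<chi> x y z - Phi2 lam G sm TM \<psi> x y z = 0" for x y z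
    using partial1_chi[of x y z] by (simp add: add_eq_0_iff)
  then show ?thesis
    using cochain delta2_psi by (simp add: cocycles2_def diff2_def prod_eq_iff fun_eq_iff)
qed

section \<open>Independence of the section\<close>

lemma action_unique:
  assumes "ext_section E G p s'"
  shows "ext_rho E i s' = \<rho>"
proof -
  interpret s': split_abelian_RB3_extension lam sm TM E G i p s'
    by unfold_locales (fact assms)
  define f where "f x = inv i (s' x - s x)" for x
  have s': "s' x = s x + i (f x)" for x
    by (simp add: f_def i_inv p_simps p_s s'.p_s)
  \<comment> \<open>In \<open>[s x + i (f x), s y + i (f y), i m]\<close> every correction term
    contains two elements of \<open>i(M)\<close>.\<close>
  show ?thesis
    by (simp add: fun_eq_iff i_eq_iff[symmetric] s'.i_rho s' lin_E brk_rules)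
qed

lemma section_difference:
  assumes "ext_section E G p s'"
  obtains f where "Vector_Spaces.linear (smul G) sm f"
    "ext_psi E G i s' - \<psi> = delta1 G \<rho> f" "ext_chi E G i s' - \<chi> = - Phi1 G TM f"
proof -
  interpret s': split_abelian_RB3_extension lam sm TM E G i p s'
    by unfold_locales (fact assms)
  define f where "f x = inv i (s' x - s x)" for x
  have i_f: "i (f x) = s' x - s x" for x
    by (simp add: f_def i_inv p_simps p_s s'.p_s)
  then have s': "s' x = s x + i (f x)" for x
    by simp
  show thesis
  proof
    show "Vector_Spaces.linear (smul G) sm f"
      using vs_M vs_G by (simp add: Vector_Spaces.linear_iff i_eq_iff[symmetric] i_simps i_f
          s_simps s'.s_simps lin_E)
    \<comment> \<open>Terms with two or more values of \<open>f\<close> vanish; the three with a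
      single value give the \<open>\<rho>\<close>-terms, and \<open>- s' (brk G x y z)\<close> gives
      \<open>- f (brk G x y z)\<close>.\<close>
    show "ext_psi E G i s' - \<psi> = delta1 G \<rho> f"
      by (simp add: fun_eq_iff i_eq_iff[symmetric] i_simps s'.i_psi delta1_def)
        (simp add: s' lin_E brk_rules i_simps algebra_simps)
    \<comment> \<open>The operator acts on \<open>i (f x)\<close> as \<open>TM\<close>, so the
      change is \<open>TM (f x) - f (rbop G x)\<close>.\<close>
    show "ext_chi E G i s' - \<chi> = - Phi1 G TM f"
      by (simp add: fun_eq_iff i_eq_iff[symmetric] i_simps s'.i_chi Phi1_def)
        (simp add: s' lin_E brk_rules i_simps algebra_simps)
  qed
qed

lemma ext_actions_eq: "ext_actions E G i p = {\<rho>}"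
  using section_s action_unique unfolding ext_actions_def by blast

lemma ext_classes_eq:
  assumes "degree0_coboundary G sm \<rho> d0"
  shows "ext_classes E G i p sm TM \<rho> d0 = {(\<psi>, \<chi>) +o coboundaries2 G sm TM \<rho> d0}"
proof -
  have "(ext_psi E G i s', ext_chi E G i s') +o coboundaries2 G sm TM \<rho> d0
      = (\<psi>, \<chi>) +o coboundaries2 G sm TM \<rho> d0" if s': "ext_section E G p s'" for s'
  proof (rule coboundaries2_coset_eqI[OF three_Lie_representation_rho lin_TM assms])
    obtain f where "Vector_Spaces.linear (smul G) sm f"
      "ext_psi E G i s' - \<psi> = delta1 G \<rho> f" "ext_chi E G i s' - \<chi> = - Phi1 G TM f"
      using section_difference[OF s'] .
    then show "(ext_psi E G i s', ext_chi E G i s') - (\<psi>, \<chi>) \<in> coboundaries2 G sm TM \<rho> d0"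
      using mem_coboundaries2[OF lin_TM assms] by simp
  qed
  then show ?thesis
    using section_s unfolding ext_classes_def by blast
qed

lemma class_in_H2: "(\<psi>, \<chi>) +o coboundaries2 G sm TM \<rho> d0 \<in> H2 lam G sm TM \<rho> d0"
  using cocycle by (simp add: H2_def)

end

section \<open>Comparison of isomorphic extensions\<close>

lemma isomorphism_transports_section:
  assumes E1: "abelian_extension lam (trivial_RB3 sm TM) E1 G i1 p1"
    and E2: "abelian_extension lam (trivial_RB3 sm TM) E2 G i2 p2"
    and hom: "RB3_hom E1 E2 \<zeta>" and i: "\<zeta> \<circ> i1 = i2" and p: "p2 \<circ> \<zeta> = p1"
    and s: "ext_section E1 G p1 s"
  shows "ext_section E2 G p2 (\<zeta> \<circ> s)" "ext_rho E2 i2 (\<zeta> \<circ> s) = ext_rho E1 i1 s"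
    "ext_psi E2 G i2 (\<zeta> \<circ> s) = ext_psi E1 G i1 s" "ext_chi E2 G i2 (\<zeta> \<circ> s) = ext_chi E1 G i1 s"
proof -
  interpret E1: split_abelian_RB3_extension lam sm TM E1 G i1 p1 s
    using E1 s by unfold_locales
  have lin: "Vector_Spaces.linear (smul E1) (smul E2) \<zeta>"
    using hom by (simp add: RB3_hom_def)
  show s2: "ext_section E2 G p2 (\<zeta> \<circ> s)"
    using s p lin by (auto simp: ext_section_def fun_eq_iff Vector_Spaces.linear_compose)
  interpret E2: split_abelian_RB3_extension lam sm TM E2 G i2 p2 "\<zeta> \<circ> s"
    using E2 s2 by unfold_locales
  have zeta: "\<zeta> (brk E1 u v w) = brk E2 (\<zeta> u) (\<zeta> v) (\<zeta> w)" "\<zeta> (rbop E1 u) = rbop E2 (\<zeta> u)" for u v w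
    using hom by (simp_all add: RB3_hom_def fun_eq_iff)
  have i2: "i2 m = \<zeta> (i1 m)" for m
    using i by auto
  \<comment> \<open>Since \<open>i2 = \<zeta> \<circ> i1\<close> is injective, values in
    \<open>M\<close> can be compared by applying \<open>\<zeta>\<close> to the defining equations in
    \<open>E1\<close>.\<close>
  have eqI: "m = n" if "i2 m = \<zeta> (i1 n)" for m n
    using that E2.i_eq_iff by (simp add: i2)
  show "ext_rho E2 i2 (\<zeta> \<circ> s) = ext_rho E1 i1 s"
    by (intro ext eqI) (simp add: E2.i_rho E1.i_rho zeta i2[symmetric])
  show "ext_psi E2 G i2 (\<zeta> \<circ> s) = ext_psi E1 G i1 s"
    by (intro ext eqI) (simp add: E2.i_psi E1.i_psi zeta linear_simps[OF lin])
  show "ext_chi E2 G i2 (\<zeta> \<circ> s) = ext_chi E1 G i1 s"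
    by (intro ext eqI) (simp add: E2.i_chi E1.i_chi zeta linear_simps[OF lin])
qed

theorem proposition5p6:
  fixes lam :: "'k::field_char_0"
    and sm :: "'k \<Rightarrow> 'm::ab_group_add \<Rightarrow> 'm"
    and TM :: "'m \<Rightarrow> 'm"
    and G :: "('k, 'g::ab_group_add) rb3"
  assumes "vector_space sm"
    and "Vector_Spaces.linear sm sm TM"
    and "RB3_Lie_algebra lam G"
  shows "RB3_Lie_algebra lam (trivial_RB3 sm TM) \<and>
    (\<forall>(E1 :: ('k, 'e1::ab_group_add) rb3) i1 p1 (E2 :: ('k, 'e2::ab_group_add) rb3) i2 p2.
       abelian_extension lam (trivial_RB3 sm TM) E1 G i1 p1 \<longrightarrow>
       abelian_extension lam (trivial_RB3 sm TM) E2 G i2 p2 \<longrightarrow>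
       isomorphic_extensions E1 i1 p1 E2 i2 p2 \<longrightarrow>
       (\<exists>\<rho>. ext_actions E1 G i1 p1 = {\<rho>} \<and> ext_actions E2 G i2 p2 = {\<rho>} \<and>
            RB3_representation lam G sm TM \<rho> \<and>
            (\<forall>d0. degree0_coboundary G sm \<rho> d0 \<longrightarrow>
               (\<exists>c \<in> H2 lam G sm TM \<rho> d0.
                  ext_classes E1 G i1 p1 sm TM \<rho> d0 = {c} \<and>
                  ext_classes E2 G i2 p2 sm TM \<rho> d0 = {c}))))"
proof (intro conjI allI impI)
  show "RB3_Lie_algebra lam (trivial_RB3 sm TM)"
    using assms(1,2) by (rule trivial_RB3_Lie_algebra)
next
  fix E1 :: "('k, 'e1) rb3" and i1 p1 and E2 :: "('k, 'e2) rb3" and i2 p2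
  assume E1: "abelian_extension lam (trivial_RB3 sm TM) E1 G i1 p1"
    and E2: "abelian_extension lam (trivial_RB3 sm TM) E2 G i2 p2"
    and "isomorphic_extensions E1 i1 p1 E2 i2 p2"
  then obtain \<zeta> where zeta: "RB3_hom E1 E2 \<zeta>" "\<zeta> \<circ> i1 = i2" "p2 \<circ> \<zeta> = p1"
    unfolding isomorphic_extensions_def by blast
  interpret E1: abelian_RB3_extension lam sm TM E1 G i1 p1
    using E1 by unfold_locales
  obtain s where s: "ext_section E1 G p1 s"
    using E1.section_exists by blast
  note transport = isomorphism_transports_section[OF E1 E2 zeta s]
  interpret E1: split_abelian_RB3_extension lam sm TM E1 G i1 p1 s
    using s by unfold_locales
  interpret E2: split_abelian_RB3_extension lam sm TM E2 G i2 p2 "\<zeta> \<circ> s"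
    using E2 transport(1) by unfold_locales
  show "\<exists>\<rho>. ext_actions E1 G i1 p1 = {\<rho>} \<and> ext_actions E2 G i2 p2 = {\<rho>} \<and>
            RB3_representation lam G sm TM \<rho> \<and>
            (\<forall>d0. degree0_coboundary G sm \<rho> d0 \<longrightarrow>
               (\<exists>c \<in> H2 lam G sm TM \<rho> d0.
                  ext_classes E1 G i1 p1 sm TM \<rho> d0 = {c} \<and>
                  ext_classes E2 G i2 p2 sm TM \<rho> d0 = {c}))"
  proof (intro exI conjI allI impI bexI)
    show "ext_actions E1 G i1 p1 = {E1.\<rho>}" "ext_actions E2 G i2 p2 = {E1.\<rho>}"
      "RB3_representation lam G sm TM E1.\<rho>"
      using E1.ext_actions_eq E2.ext_actions_eq E1.RB3_representation_rho
      by (simp_all only: transport(2))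
  next
    fix d0 assume d0: "degree0_coboundary G sm E1.\<rho> d0"
    \<comment> \<open>The class computed from \<open>s\<close> in \<open>E1\<close>; by
      \<open>transport\<close> it is also the one computed from \<open>\<zeta> \<circ> s\<close> in
      \<open>E2\<close>.\<close>
    let ?c = "(E1.\<psi>, E1.\<chi>) +o coboundaries2 G sm TM E1.\<rho> d0"
    show "?c \<in> H2 lam G sm TM E1.\<rho> d0"
      by (rule E1.class_in_H2)
    show "ext_classes E1 G i1 p1 sm TM E1.\<rho> d0 = {?c}"
      using d0 by (rule E1.ext_classes_eq)
    show "ext_classes E2 G i2 p2 sm TM E1.\<rho> d0 = {?c}"
      using E2.ext_classes_eq[of d0] d0 by (simp only: transport(2-4))
  qed
qed

end
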